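(* Suppose $a,b,c>0$. Then the functions $$\mu\mapsto\frac{\partial}{\partial a}\,{}_3F_2\left(\begin{matrix}a,\ b,\ \mu\\ c,\ 2\mu\end{matrix};x\right),\qquad \mu\mapsto-\frac{\partial}{\partial c}\,{}_3F_2\left(\begin{matrix}a,\ b,\ \mu\\ c,\ 2\mu\end{matrix};x\right)$$ are coefficient-wise log-convex on $(0,\infty)$.
   Context: $(\mu)_n$ is the rising factorial: $(\mu)_0=1$, $(\mu)_n=\mu(\mu+1)\cdots(\mu+n-1)$. ${}_3F_2\left(\begin{matrix}c_1,c_2,c_3\\ d_1,d_2\end{matrix};x\right)=\sum_{n\ge0}\frac{(c_1)_n(c_2)_n(c_3)_n}{(d_1)_n(d_2)_n\,n!}x^n$, and the parameter derivatives are taken term by term, giving power series in $x$. For a formal power series $f(\mu;x)$ in $x$ with coefficients that are non-negative functions of $\mu>0$, put $\Delta_f(\alpha,\beta;x)=f(\mu+\alpha;x)f(\mu+\beta;x)-f(\mu;x)f(\mu+\alpha+\beta;x)=\sum_k\delta_kx^k$. It is coefficient-wise log-convex on $(0,\infty)$ if $\delta_k\le0$ for all $k\ge0$, $\mu>0$, $\alpha,\beta\ge0$. *)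

theory Defs
  imports "HOL-Analysis.Analysis" "HOL-Computational_Algebra.Formal_Power_Series"
begin

definition hyp_3F2 :: "real \<Rightarrow> real \<Rightarrow> real \<Rightarrow> real \<Rightarrow> real \<Rightarrow> real fps" where
  "hyp_3F2 c1 c2 c3 d1 d2 = fps_hypergeo [c1, c2, c3] [d1, d2] 1"

lemma hyp_3F2_nth:
  "fps_nth (hyp_3F2 c1 c2 c3 d1 d2) n =
     pochhammer c1 n * pochhammer c2 n * pochhammer c3 n /
     (pochhammer d1 n * pochhammer d2 n * fact n)"
  by (simp add: hyp_3F2_def fps_hypergeo_def)

definition param_deriv :: "(real \<Rightarrow> real fps) \<Rightarrow> real \<Rightarrow> real fps" where
  "param_deriv F s = Abs_fps (\<lambda>n. deriv (\<lambda>t. fps_nth (F t) n) s)"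

definition fps_Delta :: "(real \<Rightarrow> real fps) \<Rightarrow> real \<Rightarrow> real \<Rightarrow> real \<Rightarrow> real fps" where
  "fps_Delta f \<mu> \<alpha> \<beta> = f (\<mu> + \<alpha>) * f (\<mu> + \<beta>) - f \<mu> * f (\<mu> + \<alpha> + \<beta>)"

text \<open>
  Log-convexity is only considered for families whose coefficients are non-negative functions
  of \<open>\<mu> > 0\<close>; the first conjunct records this.
\<close>

definition coeffwise_log_convex :: "(real \<Rightarrow> real fps) \<Rightarrow> bool" where
  "coeffwise_log_convex f \<longleftrightarrow>
     (\<forall>k. \<forall>\<mu>>0. fps_nth (f \<mu>) k \<ge> 0) \<and>
     (\<forall>k. \<forall>\<mu>>0. \<forall>\<alpha>\<ge>0. \<forall>\<beta>\<ge>0. fps_nth (fps_Delta f \<mu> \<alpha> \<beta>) k \<le> 0)"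

end

theory Submission
  imports Defs
begin

text \<open>
  Every coefficient of the two families is a non-negative number times \<open>(\<mu>)\<^sub>n / (2\<mu>)\<^sub>n\<close>, which is
  the \<open>n\<close>-th moment of the symmetric beta distribution on \<open>[0, 1]\<close>. Substituting \<open>t = (1 + u) / 2\<close>
  and expanding \<open>(1 + u)\<^sup>n\<close> writes it as a combination, with non-negative coefficients not depending
  on \<open>\<mu>\<close>, of the even moments \<open>(1/2)\<^sub>m / (\<mu> + 1/2)\<^sub>m\<close> of \<open>u\<close>. Collecting terms in a Cauchy product, the
  coefficient of \<open>1 / (x)\<^sub>m \<cdot> 1 / (y)\<^sub>l\<close> is non-negative and symmetric in \<open>m, l\<close>, so it remains to treat
  a symmetrised pair. For \<open>m \<le> l\<close> it equals \<open>1 / ((x)\<^sub>m (y)\<^sub>m)\<close> times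
  \<open>1 / (x + m)\<^sub>l\<^sub>-\<^sub>m + 1 / (y + m)\<^sub>l\<^sub>-\<^sub>m\<close>; the first factor is controlled by log-convexity and the
  second by convexity of \<open>x \<mapsto> 1 / (x)\<^sub>n\<close>.
\<close>

section \<open>Shift inequalities for reciprocals of rising factorials\<close>

text \<open>Factor by factor: the two products of linear terms differ by
  \<open>\<alpha> * \<beta>\<close>, which is non-negative.\<close>

lemma pochhammer_mult_shift_le:
  fixes x \<alpha> \<beta> :: real
  assumes "x > 0" "\<alpha> \<ge> 0" "\<beta> \<ge> 0"
  shows "pochhammer x n * pochhammer (x + \<alpha> + \<beta>) n \<le> pochhammer (x + \<alpha>) n * pochhammer (x + \<beta>) n"
proof (induction n)
  case (Suc n)
  have "(x + real n) * (x + \<alpha> + \<beta> + real n) \<le> (x + \<alpha> + real n) * (x + \<beta> + real n)"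
    using assms by (simp add: algebra_simps)
  then have "(pochhammer x n * pochhammer (x + \<alpha> + \<beta>) n) * ((x + real n) * (x + \<alpha> + \<beta> + real n))
      \<le> (pochhammer (x + \<alpha>) n * pochhammer (x + \<beta>) n) * ((x + \<alpha> + real n) * (x + \<beta> + real n))"
    using assms by (intro mult_mono[OF Suc.IH]) (auto intro!: mult_nonneg_nonneg pochhammer_nonneg)
  then show ?case by (simp add: pochhammer_Suc algebra_simps)
qed simp

lemma pochhammer_mono_real:
  fixes x y :: real
  assumes "0 < x" "x \<le> y"
  shows "pochhammer x n \<le> pochhammer y n"
  unfolding pochhammer_prod using assms by (intro prod_mono) auto

lemma inverse_pochhammer_mult_shift_le:
  fixes x \<alpha> \<beta> :: real
  assumes "x > 0" "\<alpha> \<ge> 0" "\<beta> \<ge> 0"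
  shows "1 / pochhammer (x + \<alpha>) n * (1 / pochhammer (x + \<beta>) n)
    \<le> 1 / pochhammer x n * (1 / pochhammer (x + \<alpha> + \<beta>) n)"
  using pochhammer_mult_shift_le[OF assms, of n] assms
  by (simp add: frac_le pochhammer_pos)

text \<open>The multiplicative inequality \<open>p * q \<le> r * s\<close>, together with the
  monotonicity bounds \<open>p \<le> r\<close> and \<open>q \<le> r\<close>, yields the additive
  one: \<open>r * (r + s - p - q) \<ge> (r - p) * (r - q) \<ge> 0\<close>.\<close>

lemma inverse_pochhammer_add_shift_le:
  fixes x \<alpha> \<beta> :: real
  assumes "x > 0" "\<alpha> \<ge> 0" "\<beta> \<ge> 0"
  shows "1 / pochhammer (x + \<alpha>) n + 1 / pochhammer (x + \<beta>) n
    \<le> 1 / pochhammer x n + 1 / pochhammer (x + \<alpha> + \<beta>) n"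
proof -
  define p q r s where "p = 1 / pochhammer (x + \<alpha>) n" and "q = 1 / pochhammer (x + \<beta>) n"
    and "r = 1 / pochhammer x n" and "s = 1 / pochhammer (x + \<alpha> + \<beta>) n"
  have "p * q \<le> r * s"
    using inverse_pochhammer_mult_shift_le[OF assms] by (simp only: p_def q_def r_def s_def)
  moreover have "p \<le> r" "q \<le> r"
    unfolding p_def q_def r_def using assms
    by (auto intro!: divide_left_mono pochhammer_mono_real mult_pos_pos pochhammer_pos)
  then have "0 \<le> (r - p) * (r - q)" by simp
  ultimately have "0 \<le> r * (r + s - p - q)" by (simp add: algebra_simps)
  moreover have "r > 0" unfolding r_def using assms by (simp add: pochhammer_pos)
  ultimately have "p + q \<le> r + s"
    by (simp add: zero_le_mult_iff)
  then show ?thesis by (simp only: p_def q_def r_def s_def)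
qed

lemma inverse_pochhammer_pair_shift_le:
  fixes x \<alpha> \<beta> :: real
  assumes "x > 0" "\<alpha> \<ge> 0" "\<beta> \<ge> 0"
  defines "R \<equiv> \<lambda>m y. 1 / pochhammer y m"
  shows "R m (x + \<alpha>) * R l (x + \<beta>) + R l (x + \<alpha>) * R m (x + \<beta>)
    \<le> R m x * R l (x + \<alpha> + \<beta>) + R l x * R m (x + \<alpha> + \<beta>)"
proof (induction m l rule: linorder_wlog)
  case (le m l)
  define Q where "Q y = R (l - m) (y + real m)" for y :: real
  have R: "R l y = R m y * Q y" for y
    using le by (simp add: R_def Q_def pochhammer_product[of m l])
  have "R m (x + \<alpha>) * R m (x + \<beta>) \<le> R m x * R m (x + \<alpha> + \<beta>)"
    unfolding R_def by (rule inverse_pochhammer_mult_shift_le) fact+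
  moreover have "Q (x + \<alpha>) + Q (x + \<beta>) \<le> Q x + Q (x + \<alpha> + \<beta>)"
    using inverse_pochhammer_add_shift_le[of "x + real m" \<alpha> \<beta> "l - m"] assms
    by (simp add: Q_def R_def add_ac)
  ultimately have "(R m (x + \<alpha>) * R m (x + \<beta>)) * (Q (x + \<alpha>) + Q (x + \<beta>))
      \<le> (R m x * R m (x + \<alpha> + \<beta>)) * (Q x + Q (x + \<alpha> + \<beta>))"
    by (rule mult_mono) (use assms in \<open>auto simp: R_def Q_def pochhammer_nonneg\<close>)
  then show ?case by (simp add: R algebra_simps)
qed (simp add: algebra_simps)

section \<open>Symmetric beta moments and their expansion\<close>

text \<open>The \<open>j\<close>-th moment of the density proportional to \<open>(1 - u\<^sup>2)\<close> \<open>powr\<close> \<open>(\<nu> - 3/2)\<close> on \<open>[-1, 1]\<close>.\<close>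

definition sym_moment :: "real \<Rightarrow> nat \<Rightarrow> real" where
  "sym_moment \<nu> j = (if even j then pochhammer (1/2) (j div 2) / pochhammer \<nu> (j div 2) else 0)"

lemma sym_moment_pair_shift_le:
  assumes "x > 0" "\<alpha> \<ge> 0" "\<beta> \<ge> 0"
  shows "sym_moment (x + \<alpha>) m * sym_moment (x + \<beta>) l + sym_moment (x + \<alpha>) l * sym_moment (x + \<beta>) m
    \<le> sym_moment x m * sym_moment (x + \<alpha> + \<beta>) l + sym_moment x l * sym_moment (x + \<alpha> + \<beta>) m"
proof (cases "even m \<and> even l")
  case True
  define K :: real where "K = pochhammer (1/2) (m div 2) * pochhammer (1/2) (l div 2)"
  have "K \<ge> 0" unfolding K_def by (intro mult_nonneg_nonneg pochhammer_nonneg) auto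
  from mult_left_mono[OF inverse_pochhammer_pair_shift_le[OF assms, of "m div 2" "l div 2"] this]
  show ?thesis using True by (simp add: sym_moment_def K_def algebra_simps)
qed (auto simp: sym_moment_def)

text \<open>For \<open>\<nu> > 1/2\<close>, multiplying the density by \<open>1 - u^2\<close> raises
  \<open>\<nu>\<close> by one; the factor \<open>1 - 1 / (2 * \<nu>)\<close> is the mean of
  \<open>1 - u^2\<close>, which renormalises. The proof is direct algebra, valid for all
  \<open>\<nu> > 0\<close>.\<close>

lemma sym_moment_diff:
  assumes "\<nu> > 0"
  shows "sym_moment \<nu> j - sym_moment \<nu> (j + 2) = (1 - 1 / (2 * \<nu>)) * sym_moment (\<nu> + 1) j"
proof (cases "even j")
  case True
  define m H P where "m = j div 2" and "H = pochhammer (1/2 :: real) m" and "P = pochhammer \<nu> m"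
  have P: "P > 0"
    using assms by (simp add: P_def pochhammer_pos)
  have "\<nu> * pochhammer (\<nu> + 1) m = P * (\<nu> + real m)"
    using pochhammer_rec[of \<nu> m] pochhammer_Suc[of \<nu> m] by (simp add: P_def)
  then have *: "pochhammer (\<nu> + 1) m = P * (\<nu> + real m) / \<nu>"
    using assms by (simp add: field_simps)
  have "H / P - H * (1/2 + real m) / (P * (\<nu> + real m))
      = (1 - 1 / (2 * \<nu>)) * (H / (P * (\<nu> + real m) / \<nu>))"
    using P assms by (simp add: divide_simps) (simp add: algebra_simps)
  then show ?thesis
    using True
    by (simp add: sym_moment_def m_def[symmetric] pochhammer_Suc * H_def[symmetric] P_def[symmetric])
qed (simp add: sym_moment_def)

text \<open>The mixed moment \<open>E [u\<^sup>j (1 + u)\<^sup>n]\<close>.\<close>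

definition shifted_moment :: "real \<Rightarrow> nat \<Rightarrow> nat \<Rightarrow> real" where
  "shifted_moment \<nu> n j = (\<Sum>i\<le>n. real (n choose i) * sym_moment \<nu> (i + j))"

lemma shifted_moment_0: "shifted_moment \<nu> 0 j = sym_moment \<nu> j"
  by (simp add: shifted_moment_def)

lemma shifted_moment_Suc:
  "shifted_moment \<nu> (Suc n) j = shifted_moment \<nu> n j + shifted_moment \<nu> n (Suc j)"
proof -
  \<comment> \<open>The extra top term has binomial coefficient zero; with it, splitting off
    \<open>i = 0\<close> lets Pascal's rule match the sums.\<close>
  have "shifted_moment \<nu> n j = (\<Sum>i\<le>Suc n. real (n choose i) * sym_moment \<nu> (i + j))"
    by (simp add: shifted_moment_def)
  then show ?thesis
    by (simp add: shifted_moment_def sum.atMost_Suc_shift[of _ n] sum.distrib algebra_simps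
        del: sum.atMost_Suc)
qed

lemma shifted_moment_diff:
  assumes "\<nu> > 0"
  shows "shifted_moment \<nu> n j - shifted_moment \<nu> n (j + 2)
    = (1 - 1 / (2 * \<nu>)) * shifted_moment (\<nu> + 1) n j"
  by (simp add: shifted_moment_def sum_subtractf[symmetric] right_diff_distrib[symmetric]
      sum_distrib_left sym_moment_diff[OF assms, of "_ + j", simplified] mult_ac)

text \<open>The moment form of \<open>(1 + u)\<^sup>2 = 2 (1 + u) - (1 - u\<^sup>2)\<close>.\<close>

lemma shifted_moment_Suc_Suc:
  assumes "\<nu> > 0"
  shows "shifted_moment \<nu> (Suc (Suc n)) 0
    = 2 * shifted_moment \<nu> (Suc n) 0 - (1 - 1 / (2 * \<nu>)) * shifted_moment (\<nu> + 1) n 0"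
  using shifted_moment_diff[OF assms, of n 0]
  by (simp add: shifted_moment_Suc numeral_2_eq_2)

text \<open>The moment form of \<open>t^(n+2) = t^(n+1) - t * (1 - t) * t^n\<close> for the beta
  distribution with both parameters \<open>\<mu>\<close>: the weight \<open>t * (1 - t)\<close> has
  mean \<open>\<mu> / (2 * (2 * \<mu> + 1))\<close> and raises \<open>\<mu>\<close> by one.\<close>

lemma pochhammer_ratio_Suc_Suc:
  fixes \<mu> :: real
  assumes "\<mu> > 0"
  shows "pochhammer \<mu> (Suc (Suc n)) / pochhammer (2 * \<mu>) (Suc (Suc n))
    = pochhammer \<mu> (Suc n) / pochhammer (2 * \<mu>) (Suc n)
      - \<mu> / (2 * (2 * \<mu> + 1)) * (pochhammer (\<mu> + 1) n / pochhammer (2 * (\<mu> + 1)) n)"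
proof -
  define P T where "P = pochhammer (\<mu> + 1) n" and "T = pochhammer (2 * \<mu> + 2) n"
  have T: "T > 0" unfolding T_def using assms by (simp add: pochhammer_pos)
  have 1: "pochhammer \<mu> (Suc n) = \<mu> * P"
    by (simp add: pochhammer_rec P_def)
  then have 2: "pochhammer \<mu> (Suc (Suc n)) = \<mu> * P * (\<mu> + real n + 1)"
    using pochhammer_Suc[of \<mu> "Suc n"] by (simp add: algebra_simps)
  have 3: "pochhammer (2 * \<mu>) (Suc (Suc n)) = 2 * \<mu> * (2 * \<mu> + 1) * T"
    by (simp add: pochhammer_rec T_def algebra_simps)
  then have 4: "pochhammer (2 * \<mu>) (Suc n) = 2 * \<mu> * (2 * \<mu> + 1) * T / (2 * \<mu> + real n + 1)"
    using pochhammer_Suc[of "2 * \<mu>" "Suc n"] assms by (simp add: field_simps)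
  have 5: "pochhammer (2 * (\<mu> + 1)) n = T" by (simp add: T_def)
  show ?thesis
    unfolding 1 2 3 4 5 P_def[symmetric]
    using T assms by (simp add: divide_simps) (simp add: algebra_simps)
qed

text \<open>Both sides satisfy the same two-step recurrence. Its last term has parameter
  \<open>\<mu> + 1\<close>, so the induction runs over all \<open>\<mu>\<close> at once.\<close>

lemma pochhammer_ratio_eq_shifted_moment:
  fixes \<mu> :: real
  assumes "\<mu> > 0"
  shows "pochhammer \<mu> n / pochhammer (2 * \<mu>) n = shifted_moment (\<mu> + 1/2) n 0 / 2 ^ n"
  using assms
proof (induction n arbitrary: \<mu> rule: induct_nat_012)
  case 0
  then show ?case by (simp add: shifted_moment_0 sym_moment_def)
next
  case 1
  then show ?case by (simp add: shifted_moment_Suc shifted_moment_0 sym_moment_def)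
next
  case (ge2 n)
  define S1 S0 where "S1 = shifted_moment (\<mu> + 1/2) (Suc n) 0"
    and "S0 = shifted_moment (\<mu> + 1 + 1/2) n 0"
  have "shifted_moment (\<mu> + 1/2) (Suc (Suc n)) 0 = 2 * S1 - (1 - 1 / (2 * (\<mu> + 1/2))) * S0"
    using shifted_moment_Suc_Suc[of "\<mu> + 1/2" n] ge2.prems by (simp add: S1_def S0_def add_ac)
  moreover have "pochhammer \<mu> (Suc (Suc n)) / pochhammer (2 * \<mu>) (Suc (Suc n))
      = S1 / 2 ^ Suc n - \<mu> / (2 * (2 * \<mu> + 1)) * (S0 / 2 ^ n)"
    using ge2.IH(1)[of "\<mu> + 1"] ge2.IH(2)[of \<mu>] ge2.prems
    by (simp only: pochhammer_ratio_Suc_Suc S1_def S0_def)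
  \<comment> \<open>The constants agree because
    \<open>1 - 1 / (2 * \<mu> + 1) = 2 * \<mu> / (2 * \<mu> + 1)\<close>, and a quarter of this is
    \<open>\<mu> / (2 * (2 * \<mu> + 1))\<close>.\<close>
  moreover have "(2 * S1 - (1 - 1 / (2 * (\<mu> + 1/2))) * S0) / 2 ^ Suc (Suc n)
      = S1 / 2 ^ Suc n - \<mu> / (2 * (2 * \<mu> + 1)) * (S0 / 2 ^ n)"
    using ge2.prems by (simp add: divide_simps)
  ultimately show ?case by simp
qed

section \<open>From symmetrised pairs to Cauchy products\<close>

text \<open>Exchanging the summation indices and using the symmetry of \<open>W\<close> makes twice
  each double sum a sum of symmetrised pairs, which are compared term by term.\<close>

lemma symmetric_bilinear_sum_le:
  fixes W :: "'a \<Rightarrow> 'a \<Rightarrow> real" and u v u' v' :: "'a \<Rightarrow> real"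
  assumes W_sym: "\<And>m l. W m l = W l m" and W_nonneg: "\<And>m l. W m l \<ge> 0"
    and le: "\<And>m l. u m * v l + u l * v m \<le> u' m * v' l + u' l * v' m"
  shows "(\<Sum>m\<in>A. \<Sum>l\<in>A. W m l * (u m * v l)) \<le> (\<Sum>m\<in>A. \<Sum>l\<in>A. W m l * (u' m * v' l))"
proof -
  have sym: "2 * (\<Sum>m\<in>A. \<Sum>l\<in>A. W m l * (p m * q l))
      = (\<Sum>m\<in>A. \<Sum>l\<in>A. W m l * (p m * q l + p l * q m))" for p q :: "'a \<Rightarrow> real"
  proof -
    have "(\<Sum>m\<in>A. \<Sum>l\<in>A. W m l * (p m * q l)) = (\<Sum>m\<in>A. \<Sum>l\<in>A. W m l * (p l * q m))"
      by (subst sum.swap) (simp add: W_sym)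
    then show ?thesis by (simp add: distrib_left sum.distrib)
  qed
  have "2 * (\<Sum>m\<in>A. \<Sum>l\<in>A. W m l * (u m * v l)) \<le> 2 * (\<Sum>m\<in>A. \<Sum>l\<in>A. W m l * (u' m * v' l))"
    unfolding sym by (intro sum_mono mult_left_mono le W_nonneg)
  then show ?thesis by simp
qed

lemma coeffwise_log_convex_pochhammer_ratio:
  fixes f :: "real \<Rightarrow> real fps" and A :: "nat \<Rightarrow> real"
  assumes f: "\<And>\<mu> n. \<mu> > 0 \<Longrightarrow> fps_nth (f \<mu>) n = A n * (pochhammer \<mu> n / pochhammer (2 * \<mu>) n)"
    and A: "\<And>n. A n \<ge> 0"
  shows "coeffwise_log_convex f"
  unfolding coeffwise_log_convex_def
proof (intro conjI allI impI)
  fix k and \<mu> :: real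
  assume "\<mu> > 0"
  then show "fps_nth (f \<mu>) k \<ge> 0"
    by (simp add: f A pochhammer_nonneg)
next
  fix k and \<mu> \<alpha> \<beta> :: real
  assume pos: "\<mu> > 0" "\<alpha> \<ge> 0" "\<beta> \<ge> 0"
  define B where "B i m = A i / 2 ^ i * real (i choose m)" for i m
  define W where "W m l = (\<Sum>i\<le>k. B i m * B (k - i) l)" for m l
  have f_eq: "fps_nth (f y) i = (\<Sum>m\<le>k. B i m * sym_moment (y + 1/2) m)" if "y > 0" "i \<le> k" for y i
  proof -
    \<comment> \<open>Since \<open>i choose m\<close> vanishes for \<open>m > i\<close>, the range
      can be extended to \<open>k\<close>, independently of \<open>i\<close>; this permits the later
      interchange of sums.\<close>
    have "(\<Sum>m\<le>k. B i m * sym_moment (y + 1/2) m) = (\<Sum>m\<le>i. B i m * sym_moment (y + 1/2) m)"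
      using that by (intro sum.mono_neutral_right) (auto simp: B_def)
    also have "\<dots> = A i * (shifted_moment (y + 1/2) i 0 / 2 ^ i)"
      by (simp add: shifted_moment_def B_def sum_distrib_left sum_divide_distrib mult_ac)
    finally show ?thesis
      using that by (simp only: f pochhammer_ratio_eq_shifted_moment)
  qed
  have prod: "fps_nth (f y * f z) k
      = (\<Sum>m\<le>k. \<Sum>l\<le>k. W m l * (sym_moment (y + 1/2) m * sym_moment (z + 1/2) l))"
    if "y > 0" "z > 0" for y z
  proof -
    have "fps_nth (f y * f z) k = (\<Sum>i\<le>k. \<Sum>m\<le>k. \<Sum>l\<le>k.
        B i m * B (k - i) l * (sym_moment (y + 1/2) m * sym_moment (z + 1/2) l))"
      using that by (simp add: fps_mult_nth atLeast0AtMost f_eq sum_product mult_ac)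
    also have "\<dots> = (\<Sum>m\<le>k. \<Sum>i\<le>k. \<Sum>l\<le>k.
        B i m * B (k - i) l * (sym_moment (y + 1/2) m * sym_moment (z + 1/2) l))"
      by (rule sum.swap)
    also have "\<dots> = (\<Sum>m\<le>k. \<Sum>l\<le>k. \<Sum>i\<le>k.
        B i m * B (k - i) l * (sym_moment (y + 1/2) m * sym_moment (z + 1/2) l))"
      by (intro sum.cong refl sum.swap)
    finally show ?thesis by (simp add: W_def sum_distrib_right)
  qed
  \<comment> \<open>Reversing the Cauchy product by \<open>i \<mapsto> k - i\<close> exchanges the
    roles of \<open>m\<close> and \<open>l\<close>.\<close>
  have W_sym: "W m l = W l m" for m l
    unfolding W_def
    by (rule sum.reindex_bij_witness[of _ "\<lambda>i. k - i" "\<lambda>i. k - i"]) (auto simp: mult_ac)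
  have W_nonneg: "W m l \<ge> 0" for m l
    unfolding W_def B_def using A by (intro sum_nonneg mult_nonneg_nonneg) auto
  have "fps_nth (f (\<mu> + \<alpha>) * f (\<mu> + \<beta>)) k \<le> fps_nth (f \<mu> * f (\<mu> + \<alpha> + \<beta>)) k"
  proof -
    have "sym_moment (\<mu> + \<alpha> + 1/2) m * sym_moment (\<mu> + \<beta> + 1/2) l
        + sym_moment (\<mu> + \<alpha> + 1/2) l * sym_moment (\<mu> + \<beta> + 1/2) m
      \<le> sym_moment (\<mu> + 1/2) m * sym_moment (\<mu> + \<alpha> + \<beta> + 1/2) l
        + sym_moment (\<mu> + 1/2) l * sym_moment (\<mu> + \<alpha> + \<beta> + 1/2) m" for m l
      using sym_moment_pair_shift_le[of "\<mu> + 1/2" \<alpha> \<beta> m l] pos by (simp add: add_ac)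
    from symmetric_bilinear_sum_le[where W = W, OF W_sym W_nonneg this] show ?thesis
      using pos by (simp add: prod)
  qed
  then show "fps_nth (fps_Delta f \<mu> \<alpha> \<beta>) k \<le> 0"
    by (simp add: fps_Delta_def)
qed

section \<open>Parameter derivatives of the coefficients\<close>

lemma pochhammer_has_nonneg_derivative:
  fixes x :: real
  assumes "x > 0"
  shows "\<exists>D\<ge>0. ((\<lambda>t. pochhammer t n) has_real_derivative D) (at x)"
proof (induction n)
  case 0
  show ?case by (intro exI[of _ 0]) simp
next
  case (Suc n)
  then obtain D where D: "D \<ge> 0" "((\<lambda>t. pochhammer t n) has_real_derivative D) (at x)" by blast
  have "((\<lambda>t. pochhammer t n * (t + real n)) has_real_derivative
      D * (x + real n) + pochhammer x n) (at x)"
    by (rule derivative_eq_intros D refl | simp)+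
  moreover have "D * (x + real n) + pochhammer x n \<ge> 0"
    using D assms by (simp add: pochhammer_nonneg)
  ultimately show ?case by (auto simp: pochhammer_Suc)
qed

theorem theorem6p7:
  fixes a b c :: real
  assumes "a > 0" and "b > 0" and "c > 0"
  shows "coeffwise_log_convex (\<lambda>\<mu>. param_deriv (\<lambda>s. hyp_3F2 s b \<mu> c (2 * \<mu>)) a) \<and>
         coeffwise_log_convex (\<lambda>\<mu>. - param_deriv (\<lambda>s. hyp_3F2 a b \<mu> s (2 * \<mu>)) c)"
proof
  obtain D where D: "\<And>n. D n \<ge> 0"
      "\<And>n. ((\<lambda>t. pochhammer t n) has_real_derivative D n) (at a)"
    using pochhammer_has_nonneg_derivative[OF assms(1)] by metis
  show "coeffwise_log_convex (\<lambda>\<mu>. param_deriv (\<lambda>s. hyp_3F2 s b \<mu> c (2 * \<mu>)) a)"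
  \<comment> \<open>Differentiating in \<open>a\<close> replaces only \<open>pochhammer a n\<close>
    by its derivative \<open>D n\<close>, so the \<open>\<mu>\<close>-dependence stays in the
    ratio.\<close>
  proof (rule coeffwise_log_convex_pochhammer_ratio)
    fix \<mu> :: real and n
    have "((\<lambda>t. pochhammer t n * pochhammer b n * pochhammer \<mu> n /
          (pochhammer c n * pochhammer (2 * \<mu>) n * fact n)) has_real_derivative
        D n * pochhammer b n * pochhammer \<mu> n / (pochhammer c n * pochhammer (2 * \<mu>) n * fact n)) (at a)"
      by (intro DERIV_cdivide DERIV_cmult_right D)
    from DERIV_imp_deriv[OF this]
    show "fps_nth (param_deriv (\<lambda>s. hyp_3F2 s b \<mu> c (2 * \<mu>)) a) n =
        D n * pochhammer b n / (pochhammer c n * fact n) * (pochhammer \<mu> n / pochhammer (2 * \<mu>) n)"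
      by (simp add: param_deriv_def hyp_3F2_nth mult_ac)
    show "D n * pochhammer b n / (pochhammer c n * fact n) \<ge> 0"
      using D assms by (simp add: pochhammer_nonneg)
  qed
next
  obtain D where D: "\<And>n. D n \<ge> 0"
      "\<And>n. ((\<lambda>t. pochhammer t n) has_real_derivative D n) (at c)"
    using pochhammer_has_nonneg_derivative[OF assms(3)] by metis
  show "coeffwise_log_convex (\<lambda>\<mu>. - param_deriv (\<lambda>s. hyp_3F2 a b \<mu> s (2 * \<mu>)) c)"
  proof (rule coeffwise_log_convex_pochhammer_ratio)
    fix \<mu> :: real and n
    \<comment> \<open>\<open>K\<close> gathers all that is constant in the differentiated parameter;
      the minus sign from differentiating the reciprocal cancels the one in the claim.\<close>
    define K where "K = pochhammer a n * pochhammer b n * pochhammer \<mu> n / (pochhammer (2 * \<mu>) n * fact n)"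
    have c: "pochhammer c n \<noteq> 0"
      using assms by (simp add: pochhammer_pos less_imp_neq[symmetric])
    have "((\<lambda>t. K * inverse (pochhammer t n)) has_real_derivative
        K * (- (D n * inverse (pochhammer c n ^ 2)))) (at c)"
      using DERIV_cmult[OF DERIV_inverse_fun[OF D(2) c]] by (simp add: numeral_2_eq_2)
    from DERIV_imp_deriv[OF this]
    have "deriv (\<lambda>t. pochhammer a n * pochhammer b n * pochhammer \<mu> n /
          (pochhammer t n * pochhammer (2 * \<mu>) n * fact n)) c
        = K * (- (D n * inverse (pochhammer c n ^ 2)))"
      by (simp add: K_def field_simps)
    then show "fps_nth (- param_deriv (\<lambda>s. hyp_3F2 a b \<mu> s (2 * \<mu>)) c) n =
        D n * pochhammer a n * pochhammer b n / (pochhammer c n ^ 2 * fact n)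
          * (pochhammer \<mu> n / pochhammer (2 * \<mu>) n)"
      by (simp add: param_deriv_def hyp_3F2_nth K_def divide_inverse mult_ac)
    show "D n * pochhammer a n * pochhammer b n / (pochhammer c n ^ 2 * fact n) \<ge> 0"
      using D assms by (simp add: pochhammer_nonneg)
  qed
qed

end
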